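(* Let $P_1=(0,0,0)$ and $P_2=(a,b,c)$ be two points of $\mathbf{Sol}$. The equidistant (bisector) surface $\mathcal{S}_{P_1P_2}$, i.e. the set of all points $(x,y,z)\in\mathbf{Sol}$ with $d^t(P_1,(x,y,z))=d^t((x,y,z),P_2)$, is given by the following implicit equations, i.e. a point $(x,y,z)$ belongs to $\mathcal{S}_{P_1P_2}$ if and only if it satisfies the equation of the case applying to it. (1) If $c\neq 0$: - for $z\neq 0$ and $z\ne c$: $$\frac{|c-z|}{|e^{c}-e^z|}\sqrt{(a-x)^2 e^{2(c+z)}+(e^{c}-e^{z})^2+(b-y)^2}=\frac{|z|}{|e^{z}-1|}\sqrt{x^2 e^{2z}+(e^{z}-1)^2+y^2};$$ - for $z=c$: $$\sqrt{(x-a)^2e^{2c}+(y-b)^2e^{-2c}}=\frac{|z|}{|e^{z}-1|}\sqrt{x^2 e^{2z}+(e^{z}-1)^2+y^2};$$ - for $z=0$: $$\frac{|c|}{|e^{c}-1|}\sqrt{(a-x)^2 e^{2c}+(e^{c}-1)^2+(b-y)^2}=\sqrt{x^2+y^2}.$$ (2) If $c=0$: - for $z\neq 0$: $$\frac{|z|}{|e^z-1|}\sqrt{(a-x)^2 e^{2z}+(e^{z}-1)^2+(b-y)^2}=\frac{|z|}{|e^{z}-1|}\sqrt{x^2 e^{2z}+(e^{z}-1)^2+y^2},$$ which is equivalent to $e^{2z}a(a-2x)+b(b-2y)=0$; - for $z=0$: $$\sqrt{(x-a)^2+(y-b)^2}=\sqrt{x^2+y^2},$$ which is equivalent to $xa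+yb-\frac{a^2+b^2}{2}=0$.
   Context: $\mathbf{Sol}$ is $\mathbb{R}^3$ with the group multiplication $(a,b,c)(x,y,z)=(x+ae^{-z},\,y+be^{z},\,z+c)$ and the Riemannian metric $ds^2=e^{2z}dx^2+e^{-2z}dy^2+dz^2$. (A point $(x,y,z)$ is also written in homogeneous coordinates as $(1,x,y,z)$.) For $P=(x,y,z)$ the translation $\tau_P$ is the map $(a,b,c)\mapsto (a,b,c)(x,y,z)=(x+ae^{-z},\,y+be^{z},\,z+c)$; it is an isometry taking the origin $O=(0,0,0)$ to $P$. Translation curves starting at the origin with initial tangent vector $(u,v,w)$ are the solutions of $\dot x=ue^{-z}$, $\dot y=ve^{z}$, $\dot z=w$, $x(0)=y(0)=z(0)=0$, i.e. $x(t)=-\frac{u}{w}(e^{-wt}-1)$, $y(t)=\frac{v}{w}(e^{wt}-1)$, $z(t)=wt$ if $w\neq0$, and $x(t)=ut$, $y(t)=vt$, $z(t)=0$ if $w=0$. Translation curves starting at an arbitrary point $P$ are the images under $\tau_P$ of translation curves starting at $O$. Between any two distinct points $P_1,P_2$ there is a unique translation curve segment starting at $P_1$ and ending at $P_2$ (up to parametrization); the translation distance $d^t(P_1,P_2)$ is its arc length with respect to the metric above (and $d^t(P,P)=0$). *)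

theory Defs
  imports "HOL-Analysis.Analysis"
begin

type_synonym sol = "real \<times> real \<times> real"

fun sol_mult :: "sol \<Rightarrow> sol \<Rightarrow> sol" where
  "sol_mult (a, b, c) (x, y, z) = (x + a * exp (- z), y + b * exp z, z + c)"

text \<open>The point \<open>P\<close> multiplies from the right, so that \<open>sol_translation P\<close> is an isometry
  of the metric below.\<close>

definition sol_translation :: "sol \<Rightarrow> sol \<Rightarrow> sol" where
  "sol_translation P Q = sol_mult Q P"

fun sol_metric :: "sol \<Rightarrow> sol \<Rightarrow> sol \<Rightarrow> real" where
  "sol_metric (x, y, z) (u, v, w) (u', v', w') =
     exp (2 * z) * (u * u') + exp (- 2 * z) * (v * v') + w * w'"

definition sol_arc_length :: "(real \<Rightarrow> sol) \<Rightarrow> real \<Rightarrow> real \<Rightarrow> real" where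
  "sol_arc_length \<gamma> s t =
     integral {s..t} (\<lambda>r. sqrt (sol_metric (\<gamma> r) (vector_derivative \<gamma> (at r)) (vector_derivative \<gamma> (at r))))"

text \<open>Right-hand side of the differential equation of translation curves; its value at
  \<open>(0, 0, 0)\<close> is the initial tangent vector \<open>(u, v, w)\<close>.\<close>

fun sol_translation_field :: "sol \<Rightarrow> sol \<Rightarrow> sol" where
  "sol_translation_field (u, v, w) (x, y, z) = (u * exp (- z), v * exp z, w)"

definition translation_curve_origin :: "sol \<Rightarrow> (real \<Rightarrow> sol) \<Rightarrow> bool" where
  "translation_curve_origin V \<gamma> \<longleftrightarrow>
     \<gamma> 0 = (0, 0, 0) \<and>
     (\<forall>t. (\<gamma> has_vector_derivative sol_translation_field V (\<gamma> t)) (at t))"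

definition translation_curve :: "sol \<Rightarrow> (real \<Rightarrow> sol) \<Rightarrow> bool" where
  "translation_curve P \<gamma> \<longleftrightarrow>
     (\<exists>V \<gamma>\<^sub>0. translation_curve_origin V \<gamma>\<^sub>0 \<and> \<gamma> = sol_translation P \<circ> \<gamma>\<^sub>0)"

text \<open>The segment joining two distinct points is unique only up to parametrization
  (rescaling \<open>V\<close> rescales \<open>T\<close>); its length does not depend on that choice.\<close>

definition translation_dist :: "sol \<Rightarrow> sol \<Rightarrow> real" where
  "translation_dist P Q =
     (if P = Q then 0
      else THE d. \<exists>\<gamma> T. translation_curve P \<gamma> \<and> 0 \<le> T \<and> \<gamma> T = Q \<and> d = sol_arc_length \<gamma> 0 T)"

definition equidistant_surface :: "sol \<Rightarrow> sol \<Rightarrow> sol set" where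
  "equidistant_surface P\<^sub>1 P\<^sub>2 = {P. translation_dist P\<^sub>1 P = translation_dist P P\<^sub>2}"

end

theory Submission
  imports Defs
begin

text \<open>Along a translation curve with initial vector \<open>(u, v, w)\<close> the left-invariant speed is the
  constant \<open>sqrt (u\<^sup>2 + v\<^sup>2 + w\<^sup>2)\<close>, so the length of a segment on \<open>[0, T]\<close> is the Euclidean norm of
  \<open>T \<cdot> (u, v, w)\<close>. This vector is determined by the end points: its last entry is the difference
  \<open>h\<close> of the heights, and the first two are the coordinate differences divided by nonzero factors
  depending only on the heights. The bisector equations follow by inserting the resulting distance
  formula.\<close>

text \<open>The mean value of \<open>exp\<close> between \<open>0\<close> and \<open>s\<close>; it treats the cases \<open>w = 0\<close> and \<open>w \<noteq> 0\<close> of the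
  explicit solutions uniformly.\<close>

definition exp_mean :: "real \<Rightarrow> real" where
  "exp_mean s = (if s = 0 then 1 else (exp s - 1) / s)"

lemma exp_mean_nonzero: "exp_mean s \<noteq> 0"
  by (simp add: exp_mean_def)

text \<open>Supplies the antiderivative of \<open>exp (w * t)\<close> that vanishes at
  \<open>0\<close>, as the initial condition of a curve from the origin requires.\<close>

lemma has_real_derivative_exp_mean:
  "((\<lambda>t. t * exp_mean (w * t)) has_real_derivative exp (w * t)) (at t)"
proof (cases "w = 0")
  case True
  then show ?thesis by (simp add: exp_mean_def)
next
  case False
  then have "(\<lambda>t. t * exp_mean (w * t)) = (\<lambda>t. (exp (w * t) - 1) / w)"
    by (auto simp: exp_mean_def fun_eq_iff)
  then show ?thesis
    using False by (auto intro!: derivative_eq_intros)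
qed

text \<open>The difference has zero derivative, hence is constant. This is all the uniqueness that
  the differential equation of translation curves needs.\<close>

lemma real_function_eqI:
  fixes f g :: "real \<Rightarrow> real"
  assumes "\<And>t. (f has_real_derivative D t) (at t)" "\<And>t. (g has_real_derivative D t) (at t)"
    and "f 0 = g 0"
  shows "f = g"
proof
  fix t
  have "((\<lambda>t. f t - g t) has_real_derivative 0) (at s)" for s
    using DERIV_diff[OF assms(1)[of s] assms(2)[of s]] by simp
  then have "f t - g t = f 0 - g 0"
    using DERIV_isconst_all by blast
  then show "f t = g t"
    using assms(3) by simp
qed

lemma has_vector_derivative_triple_iff:
  fixes \<gamma> :: "real \<Rightarrow> sol"
  shows "(\<gamma> has_vector_derivative (u, v, w)) (at t) \<longleftrightarrow>
    ((\<lambda>t. fst (\<gamma> t)) has_real_derivative u) (at t) \<and>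
    ((\<lambda>t. fst (snd (\<gamma> t))) has_real_derivative v) (at t) \<and>
    ((\<lambda>t. snd (snd (\<gamma> t))) has_real_derivative w) (at t)" (is "?L \<longleftrightarrow> ?R")
proof
  assume L: ?L
  note snd = bounded_linear.has_vector_derivative[OF bounded_linear_snd]
  note fst = bounded_linear.has_vector_derivative[OF bounded_linear_fst]
  show ?R
    using fst[OF L] fst[OF snd[OF L]] snd[OF snd[OF L]]
    by (simp add: has_real_derivative_iff_has_vector_derivative)
next
  assume ?R
  then have "((\<lambda>t. (fst (\<gamma> t), fst (snd (\<gamma> t)), snd (snd (\<gamma> t))))
      has_vector_derivative (u, v, w)) (at t)"
    by (intro has_vector_derivative_Pair)
      (auto simp: has_real_derivative_iff_has_vector_derivative)
  then show ?L by simp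
qed

text \<open>The system is triangular: the height equation involves no other coordinate and gives
  \<open>w * t\<close>. Once this is inserted, the other two right-hand sides depend on
  \<open>t\<close> alone and are integrated directly.\<close>

lemma translation_curve_origin_iff:
  "translation_curve_origin (u, v, w) \<gamma> \<longleftrightarrow>
    \<gamma> = (\<lambda>t. (u * (t * exp_mean (- (w * t))), v * (t * exp_mean (w * t)), w * t))"
    (is "_ \<longleftrightarrow> \<gamma> = ?g")
proof
  have x: "((\<lambda>t. u * (t * exp_mean (- (w * t)))) has_real_derivative u * exp (- (w * t))) (at t)" for t
    using DERIV_cmult[OF has_real_derivative_exp_mean[of "- w" t], of u] by simp
  have y: "((\<lambda>t. v * (t * exp_mean (w * t))) has_real_derivative v * exp (w * t)) (at t)" for t
    using DERIV_cmult[OF has_real_derivative_exp_mean[of w t], of v] by simp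
  have z: "((\<lambda>t. w * t) has_real_derivative w) (at t)" for t
    by (auto intro!: derivative_eq_intros)
  {
    assume "\<gamma> = ?g"
    then show "translation_curve_origin (u, v, w) \<gamma>"
      using x y z by (simp add: translation_curve_origin_def has_vector_derivative_triple_iff)
  next
    assume "translation_curve_origin (u, v, w) \<gamma>"
    then have 0: "\<gamma> 0 = (0, 0, 0)"
      and "\<And>t. (\<gamma> has_vector_derivative (u * exp (- snd (snd (\<gamma> t))), v * exp (snd (snd (\<gamma> t))), w)) (at t)"
      unfolding translation_curve_origin_def by (metis prod.collapse sol_translation_field.simps)+
    then have X: "((\<lambda>t. fst (\<gamma> t)) has_real_derivative u * exp (- snd (snd (\<gamma> t)))) (at t)"
      and Y: "((\<lambda>t. fst (snd (\<gamma> t))) has_real_derivative v * exp (snd (snd (\<gamma> t)))) (at t)"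
      and Z: "((\<lambda>t. snd (snd (\<gamma> t))) has_real_derivative w) (at t)" for t
      by (auto simp: has_vector_derivative_triple_iff)
    have Z': "(\<lambda>t. snd (snd (\<gamma> t))) = (\<lambda>t. w * t)"
      using 0 by (intro real_function_eqI[OF Z z]) simp
    have "(\<lambda>t. fst (\<gamma> t)) = (\<lambda>t. u * (t * exp_mean (- (w * t))))"
      using X 0 fun_cong[OF Z'] by (intro real_function_eqI[OF _ x]) auto
    moreover have "(\<lambda>t. fst (snd (\<gamma> t))) = (\<lambda>t. v * (t * exp_mean (w * t)))"
      using Y 0 fun_cong[OF Z'] by (intro real_function_eqI[OF _ y]) auto
    ultimately show "\<gamma> = ?g"
      using Z' by (auto simp: fun_eq_iff prod_eq_iff)
  }
qed

lemma sol_arc_length_translation_curve: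
  assumes "translation_curve_origin (u, v, w) \<gamma>" "0 \<le> T"
  shows "sol_arc_length (sol_translation P \<circ> \<gamma>) 0 T = T * sqrt (u\<^sup>2 + v\<^sup>2 + w\<^sup>2)"
proof -
  obtain p q r where P: "P = (p, q, r)" by (metis prod.collapse)
  define x y z where "x = (\<lambda>t. fst (\<gamma> t))" "y = (\<lambda>t. fst (snd (\<gamma> t)))" "z = (\<lambda>t. snd (snd (\<gamma> t)))"
  have g: "\<gamma> t = (x t, y t, z t)" for t
    by (simp add: x_y_z_def)
  have comp: "(sol_translation P \<circ> \<gamma>) = (\<lambda>t. (p + x t * exp (- r), q + y t * exp r, r + z t))"
    by (simp add: fun_eq_iff sol_translation_def P g)
  have "(\<gamma> has_vector_derivative (u * exp (- z t), v * exp (z t), w)) (at t)" for t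
    using assms(1) unfolding translation_curve_origin_def by (metis g sol_translation_field.simps)
  then have x: "(x has_real_derivative u * exp (- z t)) (at t)"
    and y: "(y has_real_derivative v * exp (z t)) (at t)"
    and z: "(z has_real_derivative w) (at t)" for t
    by (auto simp: has_vector_derivative_triple_iff g)
  \<comment> \<open>The constant factors \<open>exp (- r)\<close> and \<open>exp r\<close> of the
    translation match the shift of the height by \<open>r\<close>, so the translated curve solves
    the same differential equation.\<close>
  have d: "((\<lambda>t. (p + x t * exp (- r), q + y t * exp r, r + z t)) has_vector_derivative
      (u * exp (- (r + z t)), v * exp (r + z t), w)) (at t)" for t
    using x[of t] y[of t] z[of t]
    by (auto simp: has_vector_derivative_triple_iff exp_add exp_diff exp_minus field_simps
        intro!: derivative_eq_intros)
  \<comment> \<open>At every height \<open>s\<close> the metric weights undo the exponentials of the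
    field.\<close>
  have cancel: "exp (2 * s) * (u * exp (- s) * (u * exp (- s))) = u\<^sup>2"
    "exp (- 2 * s) * (v * exp s * (v * exp s)) = v\<^sup>2" for s :: real
    unfolding mult_minus_left mult_2 exp_add exp_minus by (simp_all add: power2_eq_square field_simps)
  have "sol_arc_length (sol_translation P \<circ> \<gamma>) 0 T = integral {0..T} (\<lambda>_. sqrt (u\<^sup>2 + v\<^sup>2 + w\<^sup>2))"
    unfolding sol_arc_length_def comp vector_derivative_at[OF d] sol_metric.simps cancel
    by (simp add: power2_eq_square)
  then show ?thesis
    using assms(2) by simp
qed

text \<open>By \<open>translation_curve_origin_iff\<close>, the three squared terms are the entries of \<open>T \<cdot> (u, v, w)\<close>.\<close>

lemma translation_dist_eq:
  "translation_dist (p, q, r) (p', q', r') =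
    sqrt (((p' - p) * exp r / exp_mean (r - r'))\<^sup>2 +
      ((q' - q) * exp (- r) / exp_mean (r' - r))\<^sup>2 + (r' - r)\<^sup>2)"
    (is "translation_dist ?P ?Q = sqrt (?U\<^sup>2 + ?V\<^sup>2 + ?W\<^sup>2)")
proof (cases "?P = ?Q")
  case True
  then show ?thesis by (simp add: translation_dist_def)
next
  case False
  let ?g = "\<lambda>u v w t. (u * (t * exp_mean (- (w * t))), v * (t * exp_mean (w * t)), w * t)"
  \<comment> \<open>Uniqueness for \<open>THE\<close>: neither \<open>V\<close> nor \<open>T\<close>
    is determined by the end points, but their product is, and the length depends only on
    it.\<close>
  have "d = sqrt (?U\<^sup>2 + ?V\<^sup>2 + ?W\<^sup>2)"
    if \<gamma>: "translation_curve ?P \<gamma>" "0 \<le> T" "\<gamma> T = ?Q" "d = sol_arc_length \<gamma> 0 T" for d \<gamma> T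
  proof -
    obtain V \<gamma>\<^sub>0 where V: "translation_curve_origin V \<gamma>\<^sub>0" "\<gamma> = sol_translation ?P \<circ> \<gamma>\<^sub>0"
      using \<gamma>(1) unfolding translation_curve_def by blast
    obtain u v w where uvw: "V = (u, v, w)"
      by (cases V)
    have comp: "\<gamma> = sol_translation ?P \<circ> ?g u v w"
      using V(1) unfolding V(2) uvw translation_curve_origin_iff by simp
    have "translation_curve_origin (u, v, w) (?g u v w)"
      by (simp add: translation_curve_origin_iff)
    then have "d = T * sqrt (u\<^sup>2 + v\<^sup>2 + w\<^sup>2)"
      unfolding \<gamma>(4) comp using \<gamma>(2) by (rule sol_arc_length_translation_curve)
    also have "\<dots> = sqrt ((u * T)\<^sup>2 + (v * T)\<^sup>2 + (w * T)\<^sup>2)"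
      using \<gamma>(2) by (simp add: power_mult_distrib real_sqrt_mult flip: distrib_right)
    finally have d: "d = \<dots>" .
    have eqs: "p' = p + u * (T * exp_mean (- (w * T))) * exp (- r)"
      "q' = q + v * (T * exp_mean (w * T)) * exp r" "r' = r + w * T"
      using \<gamma>(3) by (auto simp: comp sol_translation_def)
    then have "?U = u * T" "?V = v * T" "?W = w * T"
      by (simp_all add: exp_mean_nonzero exp_minus)
    then show ?thesis
      by (simp only: d)
  qed
  \<comment> \<open>Existence for \<open>THE\<close>: take \<open>T = 1\<close>, so that the
    required product is itself the initial vector.\<close>
  moreover have "\<exists>\<gamma> T. translation_curve ?P \<gamma> \<and> 0 \<le> T \<and> \<gamma> T = ?Q \<and>
    sqrt (?U\<^sup>2 + ?V\<^sup>2 + ?W\<^sup>2) = sol_arc_length \<gamma> 0 T"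
  proof (intro exI conjI)
    have g: "translation_curve_origin (?U, ?V, ?W) (?g ?U ?V ?W)"
      by (simp add: translation_curve_origin_iff)
    then show "translation_curve ?P (sol_translation ?P \<circ> ?g ?U ?V ?W)"
      unfolding translation_curve_def by blast
    show "(sol_translation ?P \<circ> ?g ?U ?V ?W) 1 = ?Q"
      by (simp add: sol_translation_def exp_mean_nonzero exp_minus mult.assoc)
    show "sqrt (?U\<^sup>2 + ?V\<^sup>2 + ?W\<^sup>2) = sol_arc_length (sol_translation ?P \<circ> ?g ?U ?V ?W) 0 1"
      using sol_arc_length_translation_curve[OF g, of 1] by simp
  qed simp
  ultimately have "(THE d. \<exists>\<gamma> T. translation_curve ?P \<gamma> \<and> 0 \<le> T \<and> \<gamma> T = ?Q \<and> d = sol_arc_length \<gamma> 0 T)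
      = sqrt (?U\<^sup>2 + ?V\<^sup>2 + ?W\<^sup>2)"
    by (intro the_equality) blast+
  then show ?thesis
    using False by (simp add: translation_dist_def)
qed

lemma translation_dist_same_height:
  "translation_dist (p, q, r) (p', q', r) =
    sqrt ((p' - p)\<^sup>2 * exp (2 * r) + (q' - q)\<^sup>2 * exp (- 2 * r))"
  by (simp add: translation_dist_eq exp_mean_def power_mult_distrib exp_double exp_minus power_inverse)

text \<open>For distinct heights the three entries in the distance formula share a factor, which
  leaves the root as an absolute value.\<close>

lemma translation_dist_different_height:
  assumes "r \<noteq> r'"
  shows "translation_dist (p, q, r) (p', q', r') =
    \<bar>r' - r\<bar> / \<bar>exp r' - exp r\<bar> *
      sqrt ((p' - p)\<^sup>2 * exp (2 * (r' + r)) + (exp r' - exp r)\<^sup>2 + (q' - q)\<^sup>2)"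
proof -
  \<comment> \<open>The reciprocal of the mean value of \<open>exp\<close> between the two
    heights.\<close>
  define k where "k = (r' - r) / (exp r' - exp r)"
  have ne: "exp r' - exp r \<noteq> 0" using assms by simp
  have U: "(p' - p) * exp r / exp_mean (r - r') = k * ((p' - p) * exp (r' + r))"
    using assms ne by (simp add: exp_mean_def k_def exp_diff exp_add divide_simps) (simp add: algebra_simps)
  have V: "(q' - q) * exp (- r) / exp_mean (r' - r) = k * (q' - q)"
    using assms ne by (simp add: exp_mean_def k_def exp_diff exp_minus divide_simps)
  have W: "r' - r = k * (exp r' - exp r)"
    using ne by (simp add: k_def)
  have "translation_dist (p, q, r) (p', q', r') =
      sqrt ((k * ((p' - p) * exp (r' + r)))\<^sup>2 + (k * (q' - q))\<^sup>2 + (k * (exp r' - exp r))\<^sup>2)"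
    unfolding translation_dist_eq U V using W by simp
  also have "\<dots> = sqrt (k\<^sup>2 * ((p' - p)\<^sup>2 * exp (2 * (r' + r)) + (exp r' - exp r)\<^sup>2 + (q' - q)\<^sup>2))"
    unfolding exp_double by (simp add: power_mult_distrib distrib_left add_ac mult_ac)
  finally show ?thesis
    by (simp add: real_sqrt_mult k_def abs_divide)
qed

theorem lemma3p3:
  fixes a b c x y z :: real
  shows
    "(c \<noteq> 0 \<longrightarrow>
       (z \<noteq> 0 \<and> z \<noteq> c \<longrightarrow>
         ((x, y, z) \<in> equidistant_surface (0, 0, 0) (a, b, c) \<longleftrightarrow>
           \<bar>c - z\<bar> / \<bar>exp c - exp z\<bar> *
             sqrt ((a - x)^2 * exp (2 * (c + z)) + (exp c - exp z)^2 + (b - y)^2)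
           = \<bar>z\<bar> / \<bar>exp z - 1\<bar> * sqrt (x^2 * exp (2 * z) + (exp z - 1)^2 + y^2))) \<and>
       (z = c \<longrightarrow>
         ((x, y, z) \<in> equidistant_surface (0, 0, 0) (a, b, c) \<longleftrightarrow>
           sqrt ((x - a)^2 * exp (2 * c) + (y - b)^2 * exp (- 2 * c))
           = \<bar>z\<bar> / \<bar>exp z - 1\<bar> * sqrt (x^2 * exp (2 * z) + (exp z - 1)^2 + y^2))) \<and>
       (z = 0 \<longrightarrow>
         ((x, y, z) \<in> equidistant_surface (0, 0, 0) (a, b, c) \<longleftrightarrow>
           \<bar>c\<bar> / \<bar>exp c - 1\<bar> * sqrt ((a - x)^2 * exp (2 * c) + (exp c - 1)^2 + (b - y)^2)
           = sqrt (x^2 + y^2)))) \<and>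
     (c = 0 \<longrightarrow>
       (z \<noteq> 0 \<longrightarrow>
         ((x, y, z) \<in> equidistant_surface (0, 0, 0) (a, b, c) \<longleftrightarrow>
           \<bar>z\<bar> / \<bar>exp z - 1\<bar> * sqrt ((a - x)^2 * exp (2 * z) + (exp z - 1)^2 + (b - y)^2)
           = \<bar>z\<bar> / \<bar>exp z - 1\<bar> * sqrt (x^2 * exp (2 * z) + (exp z - 1)^2 + y^2)) \<and>
         (\<bar>z\<bar> / \<bar>exp z - 1\<bar> * sqrt ((a - x)^2 * exp (2 * z) + (exp z - 1)^2 + (b - y)^2)
           = \<bar>z\<bar> / \<bar>exp z - 1\<bar> * sqrt (x^2 * exp (2 * z) + (exp z - 1)^2 + y^2) \<longleftrightarrow>
           exp (2 * z) * a * (a - 2 * x) + b * (b - 2 * y) = 0)) \<and>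
       (z = 0 \<longrightarrow>
         ((x, y, z) \<in> equidistant_surface (0, 0, 0) (a, b, c) \<longleftrightarrow>
           sqrt ((x - a)^2 + (y - b)^2) = sqrt (x^2 + y^2)) \<and>
         (sqrt ((x - a)^2 + (y - b)^2) = sqrt (x^2 + y^2) \<longleftrightarrow>
           x * a + y * b - (a^2 + b^2) / 2 = 0)))"
proof -
  \<comment> \<open>The sides are swapped to agree with the stated equations; \<open>c\<close> and
    \<open>z\<close> are kept general so that special heights can be substituted.\<close>
  have surface: "(x, y, z) \<in> equidistant_surface (0, 0, 0) (a, b, c) \<longleftrightarrow>
      translation_dist (x, y, z) (a, b, c) = translation_dist (0, 0, 0) (x, y, z)" for c z
    by (auto simp: equidistant_surface_def)
  have origin: "translation_dist (0, 0, 0) (x, y, z) =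
      \<bar>z\<bar> / \<bar>exp z - 1\<bar> * sqrt (x^2 * exp (2 * z) + (exp z - 1)^2 + y^2)" if "z \<noteq> 0" for z
    using that translation_dist_different_height[of 0 z] by simp
  have origin': "translation_dist (0, 0, 0) (x, y, 0) = sqrt (x^2 + y^2)"
    by (simp add: translation_dist_same_height)
  have generic: ?thesis if "c \<noteq> 0"
    using that
    by (auto simp: surface origin origin' translation_dist_same_height
        translation_dist_different_height power2_commute[of x a] power2_commute[of y b])
  \<comment> \<open>The radicands must agree, and their quadratic terms in \<open>x\<close> and
    \<open>y\<close> cancel.\<close>
  have plane: "sqrt ((x - a)^2 + (y - b)^2) = sqrt (x^2 + y^2) \<longleftrightarrow> x * a + y * b - (a^2 + b^2) / 2 = 0"
    by (auto simp: power2_eq_square algebra_simps)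
  have "\<bar>z\<bar> / \<bar>exp z - 1\<bar> * sqrt ((a - x)^2 * exp (2 * z) + (exp z - 1)^2 + (b - y)^2)
      = \<bar>z\<bar> / \<bar>exp z - 1\<bar> * sqrt (x^2 * exp (2 * z) + (exp z - 1)^2 + y^2) \<longleftrightarrow>
      exp (2 * z) * a * (a - 2 * x) + b * (b - 2 * y) = 0" if "z \<noteq> 0"
  proof -
    \<comment> \<open>The left side is the difference of the two radicands; the common factor before
      the roots is nonzero for \<open>z \<noteq> 0\<close> and cancels.\<close>
    have "exp (2 * z) * a * (a - 2 * x) + b * (b - 2 * y) =
        ((a - x)^2 * exp (2 * z) + (exp z - 1)^2 + (b - y)^2) - (x^2 * exp (2 * z) + (exp z - 1)^2 + y^2)"
      by (simp add: power2_eq_square algebra_simps)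
    then show ?thesis
      using that by auto
  qed
  \<comment> \<open>The general formula gives the differences \<open>0 - z\<close> and
    \<open>1 - exp z\<close>; absolute values and squares absorb the signs.\<close>
  moreover have "translation_dist (x, y, z) (a, b, 0) =
      \<bar>z\<bar> / \<bar>exp z - 1\<bar> * sqrt ((a - x)^2 * exp (2 * z) + (exp z - 1)^2 + (b - y)^2)" if "z \<noteq> 0"
    using that translation_dist_different_height[of z 0]
    by (simp add: abs_minus_commute[of 1] power2_commute[of 1])
  moreover have "translation_dist (x, y, 0) (a, b, 0) = sqrt ((x - a)^2 + (y - b)^2)"
    by (simp add: translation_dist_same_height power2_commute)
  ultimately have ?thesis if "c = 0"
    using that plane by (simp add: surface origin origin')
  with generic show ?thesis by blast
qed

end
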